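(* Let $(X,Y,\pi,\nu)$ be a factor quadruple with finite degree $d$. Then $$d=\sum_{\mu} m_\pi(\mu),$$ where $\mu$ runs over all ergodic lifts of $\nu$, i.e. all $\mu\in E(X)$ with $\pi\mu=\nu$, and $m_\pi(\mu)$ is the multiplicity of $\mu$ with respect to $\pi$.
   Context: A topological dynamical system $(X,T)$ is a compact metric space $X$ with a homeomorphism $T:X\to X$. "Measure" means Borel probability measure; $E(X)=E(X,T)$ is the set of ergodic $T$-invariant measures. A factor map $\pi:(X,T)\to(Y,S)$ is a continuous surjection with $\pi\circ T=S\circ\pi$. For a measure $\mu$ on $X$, $\pi\mu$ denotes the pushforward $\mu\circ\pi^{-1}$ (similarly for other maps). A factor quadruple $(X,Y,\pi,\nu)$ consists of a factor map $\pi:(X,T)\to(Y,S)$ between topological dynamical systems and $\nu\in E(Y,S)$. The function $y\mapsto|\pi^{-1}(y)|\in\{1,2,\dots\}\cup\{\infty\}$ is $\nu$-a.e. constant; the constant is the degree $d_{\pi,\nu}$ of the quadruple. $X^n$ carries the product action $T\times\cdots\times T$, and $p_i:X^n\to X$ is the $i$-th coordinate projection. The fiber product is $X^n_\pi=\{(x_1,\dots,x_n)\in X^n:\pi(x_1)=\cdots=\pi(x_n)\}$. An $n$-fold $\pi$-relative joining is an invariant measure $\lambda$ on $X^n$ with $\lambda(X^n_\pi)=1$; it is over $\nu$ if $\pi p_i\lambda=\nu$ for some (equivalently all) $i$. It is separating if for $\lambda$-a.e. $(x_1,\dots,x_n)$ the points $x_1,\dots,x_n$ are pairwise distinct. If $d=d_{\pi,\nu}<\infty$,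 a degree joining over $\nu$ with respect to $\pi$ is a $d$-fold ergodic separating $\pi$-relative joining over $\nu$ (a measure on $X^d$). Degree joinings exist and are unique up to a permutation of the $d$ coordinates. Multiplicity: for an ergodic lift $\mu\in E(X)$ of $\nu$, $m_\pi(\mu):=\#\{i:1\le i\le d,\ p_i\lambda=\mu\}$, where $\lambda$ is any degree joining over $\nu$ (this does not depend on the choice of $\lambda$). *)

theory Defs
  imports "HOL-Probability.Probability" "HOL-Library.Extended_Nat"
begin

text \<open>The phase spaces are whole types; their compactness is part of \<open>tds\<close>.\<close>

definition tds :: "('a::metric_space \<Rightarrow> 'a) \<Rightarrow> bool" where
  "tds (T :: 'a \<Rightarrow> 'a) \<longleftrightarrow> compact (UNIV :: 'a set) \<and> (\<exists>T'. homeomorphism UNIV UNIV T T')"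

definition factor_map ::
  "('a::metric_space \<Rightarrow> 'a) \<Rightarrow> ('b::metric_space \<Rightarrow> 'b) \<Rightarrow> ('a \<Rightarrow> 'b) \<Rightarrow> bool" where
  "factor_map T S \<pi> \<longleftrightarrow>
     tds T \<and> tds S \<and> continuous_on UNIV \<pi> \<and> surj \<pi> \<and> \<pi> \<circ> T = S \<circ> \<pi>"

text \<open>In the next two definitions the measurable space \<open>B\<close> only supplies the sigma-algebra;
  its measure is irrelevant. It is \<open>borel\<close> for \<open>X\<close> and \<open>Y\<close>, and \<open>power_space n\<close> below for \<open>X\<^sup>n\<close>.\<close>

definition invariant_measures :: "'c measure \<Rightarrow> ('c \<Rightarrow> 'c) \<Rightarrow> 'c measure set" where
  "invariant_measures B F =
     {\<mu>. prob_space \<mu> \<and> sets \<mu> = sets B \<and> F \<in> measurable B B \<and> distr \<mu> B F = \<mu>}"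

definition ergodic_measures :: "'c measure \<Rightarrow> ('c \<Rightarrow> 'c) \<Rightarrow> 'c measure set" where
  "ergodic_measures B F =
     {\<mu> \<in> invariant_measures B F.
        \<forall>A \<in> sets B. F -` A \<inter> space B = A \<longrightarrow> measure \<mu> A = 0 \<or> measure \<mu> A = 1}"

definition factor_quadruple ::
  "('a::metric_space \<Rightarrow> 'a) \<Rightarrow> ('b::metric_space \<Rightarrow> 'b)
     \<Rightarrow> ('a \<Rightarrow> 'b) \<Rightarrow> 'b measure \<Rightarrow> bool" where
  "factor_quadruple T S \<pi> \<nu> \<longleftrightarrow> factor_map T S \<pi> \<and> \<nu> \<in> ergodic_measures borel S"

definition fiber_card :: "('a \<Rightarrow> 'b) \<Rightarrow> 'b \<Rightarrow> enat" where
  "fiber_card \<pi> y = (if finite (\<pi> -` {y}) then enat (card (\<pi> -` {y})) else \<infinity>)"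

text \<open>For a factor quadruple, \<open>fiber_card \<pi>\<close> is \<open>\<nu>\<close>-a.e. constant, and the constant is unique
  because \<open>\<nu>\<close> is a probability measure.\<close>

definition factor_degree :: "('a \<Rightarrow> 'b) \<Rightarrow> 'b measure \<Rightarrow> enat" where
  "factor_degree \<pi> \<nu> = (THE c. AE y in \<nu>. fiber_card \<pi> y = c)"

text \<open>Points of \<open>X\<^sup>n\<close> are the extensional functions on \<open>{..<n}\<close>; coordinates are numbered
  from \<open>0\<close>. Since a compact metric space is second countable, the product sigma-algebra is the
  Borel sigma-algebra of \<open>X\<^sup>n\<close>.\<close>

definition power_space :: "nat \<Rightarrow> (nat \<Rightarrow> 'a::topological_space) measure" where
  "power_space n = (\<Pi>\<^sub>M i\<in>{..<n}. borel)"

definition power_map :: "nat \<Rightarrow> ('a \<Rightarrow> 'a) \<Rightarrow> (nat \<Rightarrow> 'a) \<Rightarrow> (nat \<Rightarrow> 'a)" where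
  "power_map n T x = (\<lambda>i\<in>{..<n}. T (x i))"

definition marginal :: "nat \<Rightarrow> (nat \<Rightarrow> 'a::topological_space) measure \<Rightarrow> 'a measure" where
  "marginal i \<rho> = distr \<rho> borel (\<lambda>x. x i)"

definition fiber_product :: "nat \<Rightarrow> ('a \<Rightarrow> 'b) \<Rightarrow> (nat \<Rightarrow> 'a) set" where
  "fiber_product n \<pi> =
     {x \<in> {..<n} \<rightarrow>\<^sub>E UNIV. \<forall>i<n. \<forall>j<n. \<pi> (x i) = \<pi> (x j)}"

definition relative_joining ::
  "nat \<Rightarrow> ('a::topological_space \<Rightarrow> 'a) \<Rightarrow> ('a \<Rightarrow> 'b) \<Rightarrow> (nat \<Rightarrow> 'a) measure \<Rightarrow> bool" where
  "relative_joining n T \<pi> \<rho> \<longleftrightarrow>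
     \<rho> \<in> invariant_measures (power_space n) (power_map n T) \<and>
     measure \<rho> (fiber_product n \<pi>) = 1"

definition joining_over ::
  "nat \<Rightarrow> ('a::topological_space \<Rightarrow> 'b::topological_space) \<Rightarrow> 'b measure \<Rightarrow> (nat \<Rightarrow> 'a) measure \<Rightarrow> bool" where
  "joining_over n \<pi> \<nu> \<rho> \<longleftrightarrow> (\<exists>i<n. distr (marginal i \<rho>) borel \<pi> = \<nu>)"

definition separating :: "nat \<Rightarrow> (nat \<Rightarrow> 'a) measure \<Rightarrow> bool" where
  "separating n \<rho> \<longleftrightarrow> (AE x in \<rho>. inj_on x {..<n})"

definition degree_joining ::
  "('a::topological_space \<Rightarrow> 'a) \<Rightarrow> ('a \<Rightarrow> 'b::topological_space) \<Rightarrow> 'b measure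
     \<Rightarrow> (nat \<Rightarrow> 'a) measure \<Rightarrow> bool" where
  "degree_joining T \<pi> \<nu> \<rho> \<longleftrightarrow>
     (\<exists>d. factor_degree \<pi> \<nu> = enat d \<and>
          relative_joining d T \<pi> \<rho> \<and>
          \<rho> \<in> ergodic_measures (power_space d) (power_map d T) \<and>
          joining_over d \<pi> \<nu> \<rho> \<and>
          separating d \<rho>)"

definition ergodic_lifts ::
  "('a::topological_space \<Rightarrow> 'a) \<Rightarrow> ('a \<Rightarrow> 'b::topological_space) \<Rightarrow> 'b measure \<Rightarrow> 'a measure set" where
  "ergodic_lifts T \<pi> \<nu> = {\<mu> \<in> ergodic_measures borel T. distr \<mu> borel \<pi> = \<nu>}"

text \<open>For a factor quadruple of finite degree, degree joinings exist and are unique up to a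
  permutation of the coordinates, so the choice of the degree joining does not matter.\<close>

definition lift_multiplicity ::
  "('a::topological_space \<Rightarrow> 'a) \<Rightarrow> ('a \<Rightarrow> 'b::topological_space) \<Rightarrow> 'b measure \<Rightarrow> 'a measure \<Rightarrow> nat" where
  "lift_multiplicity T \<pi> \<nu> \<mu> =
     card {i. enat i < factor_degree \<pi> \<nu> \<and> marginal i (SOME \<rho>. degree_joining T \<pi> \<nu> \<rho>) = \<mu>}"

end

theory Submission
  imports Defs
begin

text \<open>Any degree joining $\lambda$ is ergodic and concentrated on the fiber product, so each of its
  $d$ marginals is an ergodic lift of $\nu$, and counting the coordinates by their marginal gives the
  sum. The substance is the existence of $\lambda$. Almost every fiber has $d$ points, so over almost
  every $y$ lie finitely many injective $d$-tuples of the fiber; counting those in $E$ and integrating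
  over $\nu$ defines a finite invariant measure on $X^d$. For an invariant set $A$ the number of
  tuples in $A$ over $y$ is an invariant function of $y$, hence a.e. constant. An invariant set for
  which this constant is positive and minimal cannot be split by an invariant set, so the restriction
  of the counting measure to it, normalized, is ergodic.\<close>

section \<open>Borel structure of compact metric spaces\<close>

text \<open>Digits 0 and 1 in base 3 cannot carry: everything after place \<open>n\<close> adds up
  to at most \<open>(1/3)^n / 2\<close>, less than the digit at \<open>n\<close> itself. Base 2
  would allow ties between different digit sequences.\<close>

lemma ternary_less:
  fixes a b :: "nat \<Rightarrow> bool"
  assumes "\<And>k. k < n \<Longrightarrow> a k = b k" "\<not> a n" "b n"
  shows "(\<Sum>k. of_bool (a k) * (1/3::real) ^ k) < (\<Sum>k. of_bool (b k) * (1/3) ^ k)"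
proof -
  have geo: "summable (\<lambda>k. (1/3::real) ^ k)" by (rule summable_geometric) simp
  have sm: "summable (\<lambda>k. of_bool (f k) * (1/3::real) ^ k)" for f :: "nat \<Rightarrow> bool"
    by (rule summable_comparison_test'[OF geo, of 0]) auto
  have split: "(\<Sum>k. of_bool (f k) * (1/3::real) ^ k) =
      (\<Sum>k. of_bool (f (k + Suc n)) * (1/3) ^ (k + Suc n)) + of_bool (f n) * (1/3) ^ n
        + (\<Sum>k<n. of_bool (f k) * (1/3) ^ k)" for f
    by (subst suminf_split_initial_segment[OF sm, of _ "Suc n"]) simp
  have "(\<Sum>k. of_bool (a (k + Suc n)) * (1/3::real) ^ (k + Suc n)) \<le> (\<Sum>k. (1/3) ^ (k + Suc n))"
    using summable_ignore_initial_segment[OF sm, of a "Suc n"]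
      summable_ignore_initial_segment[OF geo, of "Suc n"]
    by (intro suminf_le) auto
  also have "\<dots> = (1/3) ^ Suc n * (\<Sum>k. (1/3) ^ k)"
    by (subst suminf_mult[symmetric, OF geo]) (simp add: power_add mult.commute)
  also have "\<dots> = (1/3) ^ n / 2"
    by (subst suminf_geometric) auto
  finally have ua: "(\<Sum>k. of_bool (a (k + Suc n)) * (1/3::real) ^ (k + Suc n)) \<le> (1/3) ^ n / 2" .
  have lb: "0 \<le> (\<Sum>k. of_bool (b (k + Suc n)) * (1/3::real) ^ (k + Suc n))"
    using summable_ignore_initial_segment[OF sm, of b "Suc n"] by (intro suminf_nonneg) auto
  have eq: "(\<Sum>k<n. of_bool (a k) * (1/3::real) ^ k) = (\<Sum>k<n. of_bool (b k) * (1/3) ^ k)"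
    using assms by (intro sum.cong) auto
  have n: "of_bool (a n) = (0::real)" "of_bool (b n) = (1::real)"
    using assms(2,3) by simp_all
  have "(0::real) < (1/3) ^ n" by simp
  with ua lb eq show ?thesis
    unfolding split[of a] split[of b] n mult_zero_left mult_1_left by linarith
qed

text \<open>Compactness gives a finite net at each scale \<open>1 / Suc n\<close>; their union is
  dense.\<close>

lemma compact_UNIV_countable_dense:
  assumes "compact (UNIV :: 'a::metric_space set)"
  obtains D :: "'a::metric_space set" where "countable D" "\<And>x e. 0 < e \<Longrightarrow> \<exists>a\<in>D. dist x a < e"
proof -
  have "\<exists>k. finite k \<and> (UNIV :: 'a set) \<subseteq> (\<Union>x\<in>k. ball x (1 / Suc n))" for n :: nat
    using seq_compact_imp_totally_bounded[OF compact_imp_seq_compact[OF assms]]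
    by (metis of_nat_0_less_iff zero_less_Suc zero_less_divide_1_iff)
  then obtain k where k: "\<And>n. finite (k n)" "\<And>n. (UNIV :: 'a set) \<subseteq> (\<Union>x\<in>k n. ball x (1 / Suc n))"
    by metis
  show thesis
  proof (rule that[of "\<Union>n. k n"])
    show "countable (\<Union>n. k n)" using k(1) by (simp add: countable_finite)
    fix x :: 'a and e :: real assume "0 < e"
    then obtain n where n: "inverse (real (Suc n)) < e" using reals_Archimedean by blast
    obtain a where "a \<in> k n" "dist a x < 1 / Suc n" using k(2)[of n] by fastforce
    then show "\<exists>a\<in>\<Union>n. k n. dist x a < e"
      using n by (intro bexI[of _ a]) (auto simp: dist_commute inverse_eq_divide)
  qed
qed

text \<open>Countably many balls separate points, so the sequence of memberships, read as ternary
  digits, determines the point. The embedding later orders the points of a fiber and turns equality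
  of points into equality of reals.\<close>

lemma compact_UNIV_borel_embedding:
  assumes "compact (UNIV :: 'a::metric_space set)"
  obtains c :: "'a::metric_space \<Rightarrow> real" where "c \<in> borel_measurable borel" "inj c"
proof -
  obtain D :: "'a set" where D: "countable D" "\<And>x e. 0 < e \<Longrightarrow> \<exists>a\<in>D. dist x a < e"
    using compact_UNIV_countable_dense[OF assms] by blast
  define \<U> where "\<U> = (\<lambda>(a, n). ball a (1 / Suc n)) ` (D \<times> (UNIV :: nat set))"
  define U where "U = from_nat_into \<U>"
  have "D \<noteq> {}" using D(2)[of 1] by auto
  then have U: "range U = \<U>"
    unfolding U_def using D(1) by (intro range_from_nat_into) (auto simp: \<U>_def)
  define c where "c = (\<lambda>x. \<Sum>n. of_bool (x \<in> U n) * (1/3::real) ^ n)"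
  have [measurable]: "U n \<in> sets borel" for n
    using U rangeI[of U n] by (auto simp: \<U>_def)
  show thesis
  proof
    show "c \<in> borel_measurable borel"
      unfolding c_def of_bool_def by measurable
    show "inj c"
    proof (rule injI, rule ccontr)
      fix x y assume c: "c x = c y" and "x \<noteq> y"
      \<comment> \<open>With radius below half of \<open>dist x y\<close>, a ball centered within
        that radius of \<open>x\<close> contains \<open>x\<close> but not \<open>y\<close>.\<close>
      then obtain m where m: "inverse (real (Suc m)) < dist x y / 2"
        using reals_Archimedean[of "dist x y / 2"] by auto
      obtain a where a: "a \<in> D" "dist x a < inverse (real (Suc m))"
        using D(2)[of "inverse (real (Suc m))" x] by auto
      have "ball a (1 / Suc m) \<in> range U" unfolding U using a(1) by (auto simp: \<U>_def)
      moreover have "x \<in> ball a (1 / Suc m)" using a(2) by (simp add: dist_commute inverse_eq_divide)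
      moreover have "y \<notin> ball a (1 / Suc m)"
        using a(2) m dist_triangle[of x y a] by (auto simp: inverse_eq_divide)
      ultimately have ex: "\<exists>n. (x \<in> U n) \<noteq> (y \<in> U n)" by blast
      \<comment> \<open>The first differing digit decides the order of the two codes, so they cannot
        be equal.\<close>
      define n where "n = (LEAST n. (x \<in> U n) \<noteq> (y \<in> U n))"
      have n: "(x \<in> U n) \<noteq> (y \<in> U n)" "\<And>k. k < n \<Longrightarrow> (x \<in> U k) = (y \<in> U k)"
        unfolding n_def using LeastI_ex[OF ex] not_less_Least by blast+
      show False
        using ternary_less[of n "\<lambda>n. x \<in> U n" "\<lambda>n. y \<in> U n"]
          ternary_less[of n "\<lambda>n. y \<in> U n" "\<lambda>n. x \<in> U n"] n c
        unfolding c_def by fastforce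
    qed
  qed
qed

section \<open>Points of the base with many preimages\<close>

text \<open>Infinite sets appear separately because their \<open>card\<close> is 0. The existential
  form can be tested with finitely many separating balls.\<close>

lemma card_ge_iff_subset:
  "infinite A \<or> k \<le> card A \<longleftrightarrow> (\<exists>P\<subseteq>A. finite P \<and> card P = k)"
  by (metis card_mono infinite_arbitrarily_large obtain_subset_with_card_n finite_subset)

lemma finite_set_separated:
  fixes P :: "'a::metric_space set"
  assumes "finite P"
  obtains e where "0 < e" "\<And>x y. x \<in> P \<Longrightarrow> y \<in> P \<Longrightarrow> x \<noteq> y \<Longrightarrow> e \<le> dist x y"
proof -
  \<comment> \<open>The extra 1 keeps the minimum positive and defined when \<open>P\<close> has at
    most one point.\<close>
  let ?D = "insert 1 ((\<lambda>(x, y). dist x y) ` {(x, y). x \<in> P \<and> y \<in> P \<and> x \<noteq> y})"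
  have "finite {(x, y). x \<in> P \<and> y \<in> P \<and> x \<noteq> y}"
    by (rule finite_subset[of _ "P \<times> P"]) (use assms in auto)
  then have fin: "finite ?D" by simp
  show thesis
  proof
    show "0 < Min ?D" using fin by (subst Min_gr_iff) auto
    show "Min ?D \<le> dist x y" if "x \<in> P" "y \<in> P" "x \<noteq> y" for x y
      using fin that by (intro Min_le) auto
  qed
qed

text \<open>There are \<open>k\<close> points of \<open>K\<close> over \<open>y\<close> iff \<open>y\<close> lies in the images of \<open>K \<inter> C\<close> for \<open>k\<close>
  pairwise disjoint balls \<open>C\<close> from a countable family; these images are compact.\<close>

lemma borel_card_fibre_ge:
  fixes \<pi> :: "'a::metric_space \<Rightarrow> 'b::metric_space"
  assumes X: "compact (UNIV :: 'a set)" and \<pi>: "continuous_on UNIV \<pi>" and K: "closed K"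
  shows "{y. infinite (K \<inter> \<pi> -` {y}) \<or> k \<le> card (K \<inter> \<pi> -` {y})} \<in> sets borel"
proof -
  obtain D :: "'a set" where D: "countable D" "\<And>x e. 0 < e \<Longrightarrow> \<exists>a\<in>D. dist x a < e"
    using compact_UNIV_countable_dense[OF X] by blast
  define \<C> where "\<C> = (\<lambda>(a, n). cball a (1 / Suc n)) ` (D \<times> (UNIV :: nat set))"
  define \<F> where "\<F> = {F. F \<subseteq> \<C> \<and> finite F \<and> card F = k \<and> disjoint F}"
  have "countable \<C>" unfolding \<C>_def using D(1) by simp
  then have "countable \<F>"
    by (rule countable_subset[OF _ countable_Collect_finite_subset, rotated]) (auto simp: \<F>_def)
  moreover have "(\<Inter>C\<in>F. \<pi> ` (K \<inter> C)) \<in> sets borel" if "F \<in> \<F>" for F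
  \<comment> \<open>The empty family occurs for \<open>k = 0\<close>; its intersection is the whole
    space.\<close>
  proof (cases "F = {}")
    case False
    have "\<pi> ` (K \<inter> C) \<in> sets borel" if "C \<in> F" for C
    proof -
      have "closed C" using that \<open>F \<in> \<F>\<close> by (auto simp: \<F>_def \<C>_def)
      then have "compact (K \<inter> C)"
        using compact_Int_closed[OF X, of "K \<inter> C"] K by auto
      then have "compact (\<pi> ` (K \<inter> C))"
        by (intro compact_continuous_image continuous_on_subset[OF \<pi>]) auto
      then show ?thesis by (simp add: compact_imp_closed)
    qed
    then show ?thesis
      using False \<open>F \<in> \<F>\<close> by (intro sets.finite_INT) (auto simp: \<F>_def)
  qed simp
  ultimately have "(\<Union>F\<in>\<F>. \<Inter>C\<in>F. \<pi> ` (K \<inter> C)) \<in> sets borel"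
    by (rule sets.countable_UN'')
  also have "(\<Union>F\<in>\<F>. \<Inter>C\<in>F. \<pi> ` (K \<inter> C)) =
      {y. \<exists>P\<subseteq>K \<inter> \<pi> -` {y}. finite P \<and> card P = k}"
  proof (intro set_eqI iffI)
    fix y assume "y \<in> (\<Union>F\<in>\<F>. \<Inter>C\<in>F. \<pi> ` (K \<inter> C))"
    then obtain F where F: "F \<in> \<F>" "\<And>C. C \<in> F \<Longrightarrow> \<exists>x. x \<in> K \<inter> C \<and> \<pi> x = y" by blast
    then obtain x where x: "\<And>C. C \<in> F \<Longrightarrow> x C \<in> K \<inter> C \<and> \<pi> (x C) = y" by metis
    \<comment> \<open>Disjointness of the balls makes the chosen points distinct, so there are
      \<open>k\<close> of them.\<close>
    have "inj_on x F"
    proof (rule inj_onI)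
      fix C C' assume "C \<in> F" "C' \<in> F" "x C = x C'"
      then have "C \<inter> C' \<noteq> {}" using x by (metis IntD2 IntI empty_iff)
      then show "C = C'" using F(1) \<open>C \<in> F\<close> \<open>C' \<in> F\<close> by (auto simp: \<F>_def disjoint_def)
    qed
    then show "y \<in> {y. \<exists>P\<subseteq>K \<inter> \<pi> -` {y}. finite P \<and> card P = k}"
      using F(1) x by (auto intro!: exI[of _ "x ` F"] simp: card_image \<F>_def)
  next
    fix y assume "y \<in> {y. \<exists>P\<subseteq>K \<inter> \<pi> -` {y}. finite P \<and> card P = k}"
    then obtain P where P: "P \<subseteq> K \<inter> \<pi> -` {y}" "finite P" "card P = k" by blast
    obtain e where e: "0 < e" "\<And>x y. x \<in> P \<Longrightarrow> y \<in> P \<Longrightarrow> x \<noteq> y \<Longrightarrow> e \<le> dist x y"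
      using finite_set_separated[OF P(2)] by blast
    \<comment> \<open>If two of the balls met at \<open>z\<close>, the path from \<open>x\<close>
      through \<open>a x\<close>, \<open>z\<close> and \<open>a x'\<close> to \<open>x'\<close>
      would have four legs, each shorter than \<open>e / 4\<close>.\<close>
    obtain m where m: "inverse (real (Suc m)) < e / 4"
      using reals_Archimedean[of "e / 4"] e(1) by auto
    have "\<exists>a\<in>D. dist x a < inverse (real (Suc m))" for x by (rule D(2)) simp
    then obtain a where a: "\<And>x. a x \<in> D" "\<And>x. dist x (a x) < inverse (real (Suc m))" by metis
    define C where "C = (\<lambda>x. cball (a x) (1 / Suc m))"
    have xC: "x \<in> C x" for x
      using a(2)[of x] by (auto simp: C_def dist_commute inverse_eq_divide)
    have dis: "C x \<inter> C x' = {}" if "x \<in> P" "x' \<in> P" "x \<noteq> x'" for x x'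
    proof (rule ccontr)
      assume "C x \<inter> C x' \<noteq> {}"
      then obtain z where "dist (a x) z \<le> inverse (real (Suc m))" "dist (a x') z \<le> inverse (real (Suc m))"
        by (auto simp: C_def inverse_eq_divide)
      then have "dist x x' < e"
        using a(2)[of x] a(2)[of x'] m dist_triangle[of x x' "a x"] dist_triangle[of "a x" x' z]
          dist_triangle[of z x' "a x'"] by (auto simp: dist_commute)
      then show False using e(2) that by fastforce
    qed
    have "inj_on C P" using dis xC by (metis disjoint_iff inj_onI)
    then have "C ` P \<in> \<F>"
      using P dis a(1) by (auto simp: \<F>_def card_image \<C>_def C_def disjoint_def)
    moreover have "y \<in> (\<Inter>C\<in>C ` P. \<pi> ` (K \<inter> C))"
      using P(1) xC by fastforce
    ultimately show "y \<in> (\<Union>F\<in>\<F>. \<Inter>C\<in>F. \<pi> ` (K \<inter> C))" by blast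
  qed
  finally show ?thesis unfolding card_ge_iff_subset .
qed

section \<open>Tuples, ranks and constancy of invariant functions\<close>

text \<open>Rank strictly increases with \<open>c\<close>, hence is injective. No point counts
  itself, so ranks stay below \<open>card P\<close>, and equal cardinalities give
  surjectivity.\<close>

lemma bij_betw_rank:
  fixes c :: "'a \<Rightarrow> 'b::linorder"
  assumes fin: "finite P" and inj: "inj_on c P"
  shows "bij_betw (\<lambda>x. card {x' \<in> P. c x' < c x}) P {..<card P}"
proof -
  let ?r = "\<lambda>x. card {x' \<in> P. c x' < c x}"
  have less: "?r x < ?r y" if "x \<in> P" "c x < c y" for x y
    using that fin by (intro psubset_card_mono psubsetI subsetI) auto
  have "inj_on ?r P"
  proof (rule inj_onI)
    fix x y assume "x \<in> P" "y \<in> P" "?r x = ?r y"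
    then have "c x = c y" using less[of x y] less[of y x] by (cases "c x" "c y" rule: linorder_cases) auto
    with \<open>x \<in> P\<close> \<open>y \<in> P\<close> show "x = y" using inj by (simp add: inj_on_def)
  qed
  moreover have "?r ` P \<subseteq> {..<card P}"
  proof
    fix r assume "r \<in> ?r ` P"
    then obtain x where x: "x \<in> P" "r = ?r x" by blast
    have "{x' \<in> P. c x' < c x} \<subset> P" using x(1) by blast
    then show "r \<in> {..<card P}" unfolding x(2) using psubset_card_mono[OF fin] by simp
  qed
  ultimately show ?thesis
    unfolding bij_betw_def using card_image[of ?r P] card_subset_eq[of "{..<card P}" "?r ` P"] by simp
qed

text \<open>Tuples are extensional, so that they are points of \<open>power_space n\<close> and a
  finite \<open>A\<close> has only finitely many of them.\<close>

definition inj_tuples :: "nat \<Rightarrow> 'a set \<Rightarrow> (nat \<Rightarrow> 'a) set" where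
  "inj_tuples n A = {z \<in> {..<n} \<rightarrow>\<^sub>E A. inj_on z {..<n}}"

text \<open>Generalizes \<open>power_map\<close> to maps between different types; besides
  \<open>T\<close> it is applied to sections, which send index tuples to tuples in a fiber.\<close>

definition tuple_map :: "nat \<Rightarrow> ('a \<Rightarrow> 'b) \<Rightarrow> (nat \<Rightarrow> 'a) \<Rightarrow> nat \<Rightarrow> 'b" where
  "tuple_map n f z = (\<lambda>i\<in>{..<n}. f (z i))"

lemma finite_inj_tuples: "finite A \<Longrightarrow> finite (inj_tuples n A)"
  by (rule finite_subset[of _ "{..<n} \<rightarrow>\<^sub>E A"]) (auto simp: inj_tuples_def intro!: finite_PiE)

lemma tuple_map_inj_tuples:
  assumes "inj_on f A" "f ` A \<subseteq> B"
  shows "tuple_map n f ` inj_tuples n A \<subseteq> inj_tuples n B"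
proof
  fix w assume "w \<in> tuple_map n f ` inj_tuples n A"
  then obtain z where z: "z \<in> {..<n} \<rightarrow>\<^sub>E A" "inj_on z {..<n}" "w = tuple_map n f z"
    by (auto simp: inj_tuples_def)
  have "inj_on w {..<n}"
    unfolding z(3) tuple_map_def using z(1,2) assms(1) by (auto simp: inj_on_def PiE_iff)
  moreover have "w \<in> {..<n} \<rightarrow>\<^sub>E B"
    unfolding z(3) tuple_map_def using z(1) assms(2) by (auto simp: PiE_iff)
  ultimately show "w \<in> inj_tuples n B" by (simp add: inj_tuples_def)
qed

lemma bij_betw_inj_tuples:
  assumes f: "bij_betw f A B"
  shows "bij_betw (tuple_map n f) (inj_tuples n A) (inj_tuples n B)"
proof (rule bij_betw_byWitness[where f' = "tuple_map n (inv_into A f)"])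
  have inj: "inj_on f A" and B: "f ` A = B" using f by (auto simp: bij_betw_def)
  show "\<forall>z\<in>inj_tuples n A. tuple_map n (inv_into A f) (tuple_map n f z) = z"
    using inj by (auto simp: inj_tuples_def tuple_map_def PiE_iff extensional_def fun_eq_iff)
  show "\<forall>z\<in>inj_tuples n B. tuple_map n f (tuple_map n (inv_into A f) z) = z"
    using B by (auto simp: inj_tuples_def tuple_map_def PiE_iff extensional_def fun_eq_iff f_inv_into_f)
  show "tuple_map n f ` inj_tuples n A \<subseteq> inj_tuples n B"
    using inj B by (intro tuple_map_inj_tuples) auto
  show "tuple_map n (inv_into A f) ` inj_tuples n B \<subseteq> inj_tuples n A"
    using B by (intro tuple_map_inj_tuples) (auto simp: inj_on_inv_into inv_into_into)
qed

text \<open>Each level set of \<open>g\<close> is invariant and so has measure 0 or 1. If none had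
  measure 1, the space would be a countable union of null sets; this is where countability of the
  codomain enters.\<close>

lemma ergodic_measures_constant:
  fixes g :: "'c \<Rightarrow> 'd::countable"
  assumes \<mu>: "\<mu> \<in> ergodic_measures B F" and g: "g \<in> measurable B (count_space UNIV)"
    and inv: "\<And>x. x \<in> space B \<Longrightarrow> g (F x) = g x"
  shows "\<exists>k. AE x in \<mu>. g x = k"
proof (rule ccontr)
  assume *: "\<nexists>k. AE x in \<mu>. g x = k"
  interpret prob_space \<mu> using \<mu> by (simp add: ergodic_measures_def invariant_measures_def)
  have sets: "sets \<mu> = sets B" and F: "F \<in> measurable B B"
    using \<mu> by (simp_all add: ergodic_measures_def invariant_measures_def)
  note space = sets_eq_imp_space_eq[OF sets]
  have "AE x in \<mu>. g x \<noteq> k" for k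
  proof -
    let ?A = "g -` {k} \<inter> space B"
    have A: "?A \<in> sets B" using g by (rule measurable_sets) simp
    have "F -` ?A \<inter> space B = ?A" using inv measurable_space[OF F] by auto
    then have "prob ?A = 0 \<or> prob ?A = 1"
      using \<mu> A by (auto simp: ergodic_measures_def)
    moreover have "prob ?A \<noteq> 1"
    proof
      assume "prob ?A = 1"
      from AE_prob_1[OF this] have "AE x in \<mu>. g x = k" by eventually_elim simp
      with * show False by blast
    qed
    ultimately have "?A \<in> null_sets \<mu>" using A sets by (auto simp: null_sets_def emeasure_eq_measure)
    from AE_not_in[OF this] show ?thesis using AE_space by eventually_elim (auto simp: space)
  qed
  then have "AE x in \<mu>. \<forall>k. g x \<noteq> k" by (intro AE_all_countable[THEN iffD2] allI)
  then have "AE x in \<mu>. False" by eventually_elim blast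
  then show False by simp
qed

text \<open>Countable additivity of counting measure; inside a finite \<open>B\<close> its values
  are the cardinalities.\<close>

lemma suminf_card_disjoint:
  assumes "disjoint_family A" and fin: "finite B"
  shows "(\<Sum>i. of_nat (card (A i \<inter> B)) :: ennreal) = of_nat (card ((\<Union>i. A i) \<inter> B))"
proof -
  have "of_nat (card (C \<inter> B)) = emeasure (count_space UNIV) (C \<inter> B)" for C
    using fin by simp
  moreover have "(\<Sum>i. emeasure (count_space UNIV) (A i \<inter> B)) = emeasure (count_space UNIV) (\<Union>i. A i \<inter> B)"
    using assms(1) by (intro suminf_emeasure) (auto simp: disjoint_family_on_def)
  ultimately show ?thesis by simp
qed

text \<open>Moves counts into \<open>ennreal\<close>, where infinite series always have a value and
  preserve measurability.\<close>

lemma measurable_count_space_of_nat_ennreal: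
  fixes f :: "'a \<Rightarrow> nat"
  shows "f \<in> measurable M (count_space UNIV) \<longleftrightarrow> (\<lambda>x. of_nat (f x) :: ennreal) \<in> borel_measurable M"
proof
  assume *: "(\<lambda>x. of_nat (f x) :: ennreal) \<in> borel_measurable M"
  have "f -` {k} \<inter> space M \<in> sets M" for k
    using measurable_sets[OF *, of "{of_nat k}"] by (simp add: vimage_def)
  then show "f \<in> measurable M (count_space UNIV)" by (simp add: measurable_count_space_eq2_countable)
next
  assume "f \<in> measurable M (count_space UNIV)"
  then show "(\<lambda>x. of_nat (f x) :: ennreal) \<in> borel_measurable M"
    by (rule measurable_compose) simp
qed

lemma tds_bij: "tds F \<Longrightarrow> bij F"
  by (auto simp: tds_def homeomorphism_def intro: bij_betw_byWitness)

lemma card_bij_betw_restrict: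
  assumes "bij_betw f A B"
  shows "card {x \<in> A. f x \<in> E} = card (E \<inter> B)"
proof -
  have "f ` A = B" using assms by (rule bij_betw_imp_surj_on)
  then have "f ` {x \<in> A. f x \<in> E} = E \<inter> B" by blast
  then have "bij_betw f {x \<in> A. f x \<in> E} (E \<inter> B)"
    by (intro bij_betw_subset[OF assms]) auto
  then show ?thesis by (rule bij_betw_same_card)
qed

lemma card_Int_singleton: "card (A \<inter> {x}) = (if x \<in> A then 1 else 0)"
  by (cases "x \<in> A") simp_all

text \<open>The threshold \<open>c x\<close> varies with the point. A rational between the largest
  smaller value and \<open>c x\<close> does the same job, which turns the condition into a countable
  union.\<close>

lemma rank_le_iff:
  fixes c :: "'c \<Rightarrow> real"
  assumes "finite P"
  shows "k \<le> card {x' \<in> P. c x' < c x} \<longleftrightarrow> (\<exists>q::rat. of_rat q \<le> c x \<and> k \<le> card {x' \<in> P. c x' < of_rat q})"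
proof
  assume k: "k \<le> card {x' \<in> P. c x' < c x}"
  \<comment> \<open>Inserting \<open>c x - 1\<close> gives the maximum a value below
    \<open>c x\<close> even when no point has a smaller code.\<close>
  let ?m = "Max (insert (c x - 1) (c ` {x' \<in> P. c x' < c x}))"
  have fin: "finite (insert (c x - 1) (c ` {x' \<in> P. c x' < c x}))" using assms by simp
  have "?m < c x" using fin by (subst Max_less_iff) auto
  then obtain q :: rat where q: "?m < of_rat q" "of_rat q < c x" using of_rat_dense by blast
  have "c x' < of_rat q" if "x' \<in> P" "c x' < c x" for x'
  proof -
    have "c x' \<le> ?m" using fin that by (intro Max_ge) auto
    then show ?thesis using q by simp
  qed
  then have "{x' \<in> P. c x' < c x} \<subseteq> {x' \<in> P. c x' < of_rat q}" by blast
  then have "card {x' \<in> P. c x' < c x} \<le> card {x' \<in> P. c x' < of_rat q}"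
    using assms by (intro card_mono) auto
  then show "\<exists>q::rat. of_rat q \<le> c x \<and> k \<le> card {x' \<in> P. c x' < of_rat q}"
    using k q by (intro exI[of _ q]) simp
next
  assume "\<exists>q::rat. of_rat q \<le> c x \<and> k \<le> card {x' \<in> P. c x' < of_rat q}"
  then obtain q :: rat where q: "of_rat q \<le> c x" "k \<le> card {x' \<in> P. c x' < of_rat q}" by blast
  have "{x' \<in> P. c x' < of_rat q} \<subseteq> {x' \<in> P. c x' < c x}" using q(1) by auto
  then have "card {x' \<in> P. c x' < of_rat q} \<le> card {x' \<in> P. c x' < c x}"
    using assms by (intro card_mono) auto
  then show "k \<le> card {x' \<in> P. c x' < c x}" using q(2) by simp
qed

lemma space_power_space [simp]: "space (power_space n) = {..<n} \<rightarrow>\<^sub>E UNIV"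
  by (simp add: power_space_def space_PiM)

lemma measurable_coordinate:
  "i < n \<Longrightarrow> (\<lambda>x. x i) \<in> borel_measurable (power_space n :: (nat \<Rightarrow> 'c::topological_space) measure)"
  unfolding power_space_def by (intro measurable_component_singleton) simp

section \<open>Generic fibers and Borel sections\<close>

locale finite_degree_quadruple =
  fixes T :: "'a::metric_space \<Rightarrow> 'a" and S :: "'b::metric_space \<Rightarrow> 'b" and \<pi> :: "'a \<Rightarrow> 'b"
    and \<nu> :: "'b measure" and d :: nat
  assumes quadruple: "factor_quadruple T S \<pi> \<nu>"
    and degree: "factor_degree \<pi> \<nu> = enat d"
begin

lemma compact_X: "compact (UNIV :: 'a set)" and compact_Y: "compact (UNIV :: 'b set)"
  using quadruple by (auto simp: factor_quadruple_def factor_map_def tds_def)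

lemma bij_T: "bij T" and bij_S: "bij S"
  using quadruple by (auto simp: factor_quadruple_def factor_map_def dest: tds_bij)

lemma continuous_T: "continuous_on UNIV T" and continuous_pi: "continuous_on UNIV \<pi>"
  and surj_pi: "surj \<pi>"
  using quadruple by (auto simp: factor_quadruple_def factor_map_def tds_def homeomorphism_def)

lemma equivariant: "\<pi> (T x) = S (\<pi> x)"
  using quadruple by (auto simp: factor_quadruple_def factor_map_def fun_eq_iff)

lemma nu_ergodic: "\<nu> \<in> ergodic_measures borel S"
  using quadruple by (simp add: factor_quadruple_def)

lemma prob_space_nu: "prob_space \<nu>" and sets_nu [simp, measurable_cong]: "sets \<nu> = sets borel"
  and distr_nu: "distr \<nu> borel S = \<nu>" and measurable_S [measurable]: "S \<in> borel_measurable borel"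
  using nu_ergodic by (simp_all add: ergodic_measures_def invariant_measures_def)

lemma space_nu [simp]: "space \<nu> = UNIV"
  using sets_eq_imp_space_eq[OF sets_nu] by simp

lemma measurable_T [measurable]: "T \<in> borel_measurable borel"
  and measurable_pi [measurable]: "\<pi> \<in> borel_measurable borel"
  using continuous_T continuous_pi by (auto intro: borel_measurable_continuous_onI)

section \<open>Invariance and measurability of the fiber cardinality\<close>

abbreviation fibre :: "'b \<Rightarrow> 'a set" where
  "fibre y \<equiv> \<pi> -` {y}"

lemma bij_betw_fibre: "bij_betw T (fibre y) (fibre (S y))"
proof -
  have "fibre (S y) \<subseteq> T ` fibre y"
  proof
    fix x assume x: "x \<in> fibre (S y)"
    obtain x' where x': "x = T x'" using bij_T by (metis bij_pointE)
    then have "S (\<pi> x') = S y" using x equivariant by simp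
    then have "\<pi> x' = y" using bij_S by (meson bij_def injD)
    then show "x \<in> T ` fibre y" using x' by auto
  qed
  moreover have "T ` fibre y \<subseteq> fibre (S y)" using equivariant by auto
  moreover have "inj_on T (fibre y)" using bij_T by (meson bij_def inj_on_subset subset_UNIV)
  ultimately show ?thesis by (auto simp: bij_betw_def)
qed

lemma fiber_card_S: "fiber_card \<pi> (S y) = fiber_card \<pi> y"
  using bij_betw_finite[OF bij_betw_fibre[of y]] bij_betw_same_card[OF bij_betw_fibre[of y]]
  by (simp add: fiber_card_def)

lemma fiber_card_ge: "enat k \<le> fiber_card \<pi> y \<longleftrightarrow> infinite (fibre y) \<or> k \<le> card (fibre y)"
  by (auto simp: fiber_card_def)

text \<open>Superlevel sets are Borel by the covering criterion. A finite value is a difference of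
  two consecutive ones, and infinity is the intersection of all.\<close>

lemma measurable_fiber_card [measurable]: "fiber_card \<pi> \<in> measurable borel (count_space UNIV)"
proof -
  have ge: "{y. enat k \<le> fiber_card \<pi> y} \<in> sets borel" for k
    using borel_card_fibre_ge[OF compact_X continuous_pi closed_UNIV, of k]
    by (simp add: fiber_card_ge)
  have "fiber_card \<pi> -` {a} \<in> sets borel" for a
  proof (cases a)
    case (enat k)
    have "x = a \<longleftrightarrow> enat k \<le> x \<and> \<not> enat (Suc k) \<le> x" for x
      unfolding enat by (cases x) auto
    then have "fiber_card \<pi> -` {a} = {y. enat k \<le> fiber_card \<pi> y} - {y. enat (Suc k) \<le> fiber_card \<pi> y}"
      by auto
    then show ?thesis using ge by auto
  next
    case infinity
    have "x = a \<longleftrightarrow> (\<forall>k. enat k \<le> x)" for x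
    proof (cases x)
      case (enat n)
      then have "\<not> enat (Suc n) \<le> x" by simp
      then show ?thesis unfolding infinity enat by blast
    qed (simp add: infinity)
    then have "fiber_card \<pi> -` {a} = (\<Inter>k. {y. enat k \<le> fiber_card \<pi> y})"
      by auto
    then show ?thesis using ge by auto
  qed
  then show ?thesis by (simp add: measurable_count_space_eq2_countable)
qed

text \<open>Ergodicity supplies some constant. Two such constants agree because \<open>\<nu>\<close>
  is a probability measure, so the definite description in \<open>factor_degree\<close> selects this
  one.\<close>

lemma AE_fiber_card: "AE y in \<nu>. fiber_card \<pi> y = enat d"
proof -
  interpret prob_space \<nu> by (rule prob_space_nu)
  obtain k where k: "AE y in \<nu>. fiber_card \<pi> y = k"
    using ergodic_measures_constant[OF nu_ergodic measurable_fiber_card] fiber_card_S by auto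
  have "factor_degree \<pi> \<nu> = k"
    unfolding factor_degree_def
  proof (rule the_equality)
    show "AE y in \<nu>. fiber_card \<pi> y = k" by (fact k)
  next
    fix k' assume "AE y in \<nu>. fiber_card \<pi> y = k'"
    with k have "AE y in \<nu>. k' = k" by eventually_elim simp
    then show "k' = k" by simp
  qed
  then show ?thesis using k degree by simp
qed

definition generic :: "'b set" where
  "generic = {y. finite (fibre y) \<and> card (fibre y) = d}"

lemma generic_iff: "y \<in> generic \<longleftrightarrow> fiber_card \<pi> y = enat d"
  by (simp add: generic_def fiber_card_def)

lemma generic_S: "S y \<in> generic \<longleftrightarrow> y \<in> generic"
  by (simp add: generic_iff fiber_card_S)

lemma generic_borel [measurable]: "generic \<in> sets borel"
proof -
  have "generic = fiber_card \<pi> -` {enat d}" by (auto simp: generic_iff)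
  then show ?thesis using measurable_sets[OF measurable_fiber_card, of "{enat d}"] by simp
qed

lemma AE_generic: "AE y in \<nu>. y \<in> generic"
  using AE_fiber_card by (simp add: generic_iff)

text \<open>Degree 0 would make almost every fiber empty, against surjectivity. It guarantees that
  coordinate 0 exists when the joining is projected to the base.\<close>

lemma degree_pos: "0 < d"
proof -
  interpret prob_space \<nu> by (rule prob_space_nu)
  have "\<exists>y. y \<in> generic"
  proof (rule ccontr)
    assume "\<nexists>y. y \<in> generic"
    with AE_generic have "AE y in \<nu>. False" by simp
    then show False by simp
  qed
  then obtain y where y: "finite (fibre y)" "card (fibre y) = d" by (auto simp: generic_def)
  obtain x where "y = \<pi> x" using surj_pi by (metis surjD)
  then have "fibre y \<noteq> {}" by auto
  with y show ?thesis by (metis card_gt_0_iff)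
qed

text \<open>The value 0 off \<open>generic\<close> avoids infinite fibers, on which
  \<open>card\<close> is not additive.\<close>

definition fibre_count :: "'a set \<Rightarrow> 'b \<Rightarrow> nat" where
  "fibre_count E y = (if y \<in> generic then card (E \<inter> fibre y) else 0)"

text \<open>A Dynkin argument starting from closed sets, for which compactness makes the superlevel
  sets Borel.\<close>

lemma measurable_fibre_count [measurable]:
  assumes "E \<in> sets borel"
  shows "fibre_count E \<in> measurable borel (count_space UNIV)"
proof -
  have "Int_stable (Collect closed :: 'a set set)" by (auto simp: Int_stable_def)
  moreover have "Collect closed \<subseteq> Pow (UNIV :: 'a set)" by simp
  moreover have "E \<in> sigma_sets UNIV (Collect closed)"
    using assms by (simp add: borel_eq_closed)
  ultimately show ?thesis
  proof (induction E rule: sigma_sets_induct_disjoint)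
    case (basic K)
    \<comment> \<open>For \<open>k = 0\<close> this is everything; a positive count already forces
      \<open>y\<close> into \<open>generic\<close>, where the infinite alternative cannot
      occur.\<close>
    have ge: "{y. k \<le> fibre_count K y} \<in> sets borel" for k
    proof (cases k)
      case (Suc k')
      have "{y. k \<le> fibre_count K y} =
          generic \<inter> {y. infinite (K \<inter> fibre y) \<or> k \<le> card (K \<inter> fibre y)}"
        using Suc by (auto simp: fibre_count_def generic_def)
      then show ?thesis
        using borel_card_fibre_ge[OF compact_X continuous_pi, of K k] basic by auto
    qed simp
    have "fibre_count K -` {k} = {y. k \<le> fibre_count K y} - {y. Suc k \<le> fibre_count K y}" for k
      by auto
    then show ?case using ge by (simp add: measurable_count_space_eq2_countable)
  next
    case empty
    have "fibre_count {} = (\<lambda>_. 0)" by (auto simp: fibre_count_def)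
    then show ?case by simp
  next
    case (compl A)
    \<comment> \<open>A generic fiber has exactly \<open>d\<close> points, so counting outside
      \<open>A\<close> is subtraction from a constant.\<close>
    have "fibre_count (UNIV - A) = (\<lambda>y. if y \<in> generic then d - fibre_count A y else 0)"
    proof
      fix y
      have "(UNIV - A) \<inter> fibre y = fibre y - A \<inter> fibre y" by auto
      then show "fibre_count (UNIV - A) y = (if y \<in> generic then d - fibre_count A y else 0)"
        by (simp add: fibre_count_def generic_def card_Diff_subset)
    qed
    moreover have "\<dots> \<in> measurable borel (count_space UNIV)"
      using compl by measurable
    ultimately show ?case by simp
  next
    case (union A)
    have "(\<lambda>y. of_nat (fibre_count (\<Union>i. A i) y) :: ennreal) = (\<lambda>y. \<Sum>i. of_nat (fibre_count (A i) y))"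
    proof
      fix y show "(of_nat (fibre_count (\<Union>i. A i) y) :: ennreal) = (\<Sum>i. of_nat (fibre_count (A i) y))"
        using suminf_card_disjoint[OF union(1), of "fibre y"]
        by (cases "y \<in> generic") (simp_all add: fibre_count_def, simp add: generic_def)
    qed
    moreover have "\<dots> \<in> borel_measurable borel"
      using union(3) by (intro borel_measurable_suminf_order) (simp flip: measurable_count_space_of_nat_ennreal)
    ultimately show ?case by (simp add: measurable_count_space_of_nat_ennreal)
  qed
qed

text \<open>The \<open>i\<close>-th section picks the point of rank \<open>i\<close> in the fiber, ordered by a Borel injection
  into the reals.\<close>

lemma borel_sections:
  "\<exists>s. (\<forall>i<d. s i \<in> borel_measurable borel) \<and> (\<forall>y\<in>generic. bij_betw (\<lambda>i. s i y) {..<d} (fibre y))"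
proof -
  obtain c :: "'a \<Rightarrow> real" where c [measurable]: "c \<in> borel_measurable borel" and inj: "inj c"
    using compact_UNIV_borel_embedding[OF compact_X] by blast
  define r where "r = (\<lambda>x. card {x' \<in> fibre (\<pi> x). c x' < c x})"
  have bij: "bij_betw r (fibre y) {..<d}" if "y \<in> generic" for y
  proof -
    have "bij_betw r (fibre y) {..<d} \<longleftrightarrow> bij_betw (\<lambda>x. card {x' \<in> fibre y. c x' < c x}) (fibre y) {..<d}"
      by (rule bij_betw_cong) (simp add: r_def)
    then show ?thesis
      using that bij_betw_rank[of "fibre y" c] inj_on_subset[OF inj] by (simp add: generic_def)
  qed
  define B where "B = (\<lambda>i. {x. \<pi> x \<in> generic \<and> r x = i})"
  have B [measurable]: "B i \<in> sets borel" for i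
  proof -
    have ge: "{x. \<pi> x \<in> generic \<and> k \<le> r x} \<in> sets borel" for k
    proof -
      have "{x. \<pi> x \<in> generic \<and> k \<le> r x} =
          (\<Union>q::rat. {x. \<pi> x \<in> generic \<and> of_rat q \<le> c x \<and> k \<le> fibre_count {x'. c x' < of_rat q} (\<pi> x)})"
      proof -
        have "{x'. c x' < of_rat q} \<inter> fibre y = {x' \<in> fibre y. c x' < of_rat q}" for q y by auto
        moreover have "k \<le> r x \<longleftrightarrow> (\<exists>q::rat. of_rat q \<le> c x \<and> k \<le> card {x' \<in> fibre (\<pi> x). c x' < of_rat q})"
          if "\<pi> x \<in> generic" for x
          unfolding r_def using that by (intro rank_le_iff) (simp add: generic_def)
        ultimately show ?thesis by (auto simp: fibre_count_def)
      qed
      also have "\<dots> \<in> sets borel"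
        by (intro sets.countable_UN'') (simp_all, measurable)
      finally show ?thesis .
    qed
    have "B i = {x. \<pi> x \<in> generic \<and> i \<le> r x} - {x. \<pi> x \<in> generic \<and> Suc i \<le> r x}"
      by (auto simp: B_def)
    then show ?thesis using ge by auto
  qed
  \<comment> \<open>Off \<open>generic\<close> the section is constant, so there a preimage is all
    or nothing.\<close>
  define s where "s = (\<lambda>i y. if y \<in> generic then inv_into (fibre y) r i else undefined)"
  have bij_s: "bij_betw (\<lambda>i. s i y) {..<d} (fibre y)" if "y \<in> generic" for y
    using bij_betw_inv_into[OF bij[OF that]] that by (simp add: s_def)
  have "s i \<in> borel_measurable borel" if "i < d" for i
  proof (rule measurableI)
    fix E :: "'a set" assume E [measurable]: "E \<in> sets borel"
    \<comment> \<open>\<open>B i\<close> meets a generic fiber in the single point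
      \<open>s i y\<close>; hence the preimage of \<open>E\<close> is a level set of the count of
      \<open>E \<inter> B i\<close>.\<close>
    have "s i y \<in> E \<longleftrightarrow> fibre_count (E \<inter> B i) y = 1" if "y \<in> generic" for y
    proof -
      have fib: "s i y \<in> fibre y"
        using bij_betw_apply[OF bij_s[OF that]] \<open>i < d\<close> by blast
      have r: "r (s i y) = i"
        using bij_betw_inv_into_right[OF bij[OF that], of i] \<open>i < d\<close> \<open>y \<in> generic\<close> by (simp add: s_def)
      have Bi: "B i \<inter> fibre y = {s i y}"
      proof (intro equalityI subsetI)
        fix x assume x: "x \<in> B i \<inter> fibre y"
        then have "r x = r (s i y)" using r by (simp add: B_def)
        then have "x = s i y"
          using x fib by (intro inj_onD[OF bij_betw_imp_inj_on[OF bij[OF that]]]) auto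
        then show "x \<in> {s i y}" by simp
      next
        fix x assume "x \<in> {s i y}"
        then show "x \<in> B i \<inter> fibre y" using fib r that by (simp add: B_def)
      qed
      have "fibre_count (E \<inter> B i) y = card (E \<inter> {s i y})"
        unfolding fibre_count_def Int_assoc Bi using that by (rule if_P)
      also have "\<dots> = (if s i y \<in> E then 1 else 0)" by (rule card_Int_singleton)
      finally show ?thesis by (simp split: if_splits)
    qed
    moreover have "s i y = undefined" if "y \<notin> generic" for y using that by (simp add: s_def)
    ultimately have "s i -` E \<inter> space borel =
        {y. y \<in> generic \<and> fibre_count (E \<inter> B i) y = 1} \<union> {y. y \<notin> generic \<and> (undefined :: 'a) \<in> E}"
      by (simp add: set_eq_iff) metis
    also have "\<dots> \<in> sets borel" by measurable
    finally show "s i -` E \<inter> space borel \<in> sets borel" .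
  qed simp
  with bij_s show ?thesis by blast
qed

section \<open>Counting injective tuples\<close>

text \<open>Over a generic point these are the \<open>d!\<close> enumerations of the fiber.\<close>

definition tuples :: "'b \<Rightarrow> (nat \<Rightarrow> 'a) set" where
  "tuples y = inj_tuples d (fibre y)"

definition tuple_count :: "(nat \<Rightarrow> 'a) set \<Rightarrow> 'b \<Rightarrow> nat" where
  "tuple_count E y = (if y \<in> generic then card (E \<inter> tuples y) else 0)"

abbreviation F :: "(nat \<Rightarrow> 'a) \<Rightarrow> nat \<Rightarrow> 'a" where
  "F \<equiv> power_map d T"

lemma finite_tuples: "y \<in> generic \<Longrightarrow> finite (tuples y)"
  by (simp add: tuples_def finite_inj_tuples generic_def)

lemma tuples_nonempty:
  assumes "y \<in> generic"
  shows "tuples y \<noteq> {}"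
proof -
  obtain h where h: "bij_betw h {..<d} (fibre y)"
    using assms ex_bij_betw_nat_finite[of "fibre y"] by (auto simp: generic_def lessThan_atLeast0)
  then have "restrict h {..<d} \<in> tuples y"
    by (auto simp: tuples_def inj_tuples_def bij_betw_def inj_on_def)
  then show ?thesis by blast
qed

lemma bij_betw_tuples: "bij_betw F (tuples y) (tuples (S y))"
proof -
  have "F = tuple_map d T" by (simp add: fun_eq_iff power_map_def tuple_map_def)
  then show ?thesis
    unfolding tuples_def using bij_betw_inj_tuples[OF bij_betw_fibre] by simp
qed

lemma tuples_space: "tuples y \<subseteq> space (power_space d)"
  by (auto simp: tuples_def inj_tuples_def)

lemma measurable_F [measurable]: "F \<in> measurable (power_space d) (power_space d)"
  unfolding power_map_def[abs_def] power_space_def by measurable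

text \<open>\<open>F\<close> carries the tuples over \<open>y\<close> bijectively to those over
  \<open>S y\<close>. Both the invariance of the counting measure and the constancy of counts of
  invariant sets rest on this.\<close>

lemma tuple_count_F:
  "tuple_count (F -` E \<inter> space (power_space d)) y = tuple_count E (S y)"
proof -
  have "F -` E \<inter> space (power_space d) \<inter> tuples y = {x \<in> tuples y. F x \<in> E}"
    using tuples_space[of y] by blast
  then show ?thesis
    using card_bij_betw_restrict[OF bij_betw_tuples, of y E]
    by (simp only: tuple_count_def generic_S)
qed

text \<open>The Borel sections parametrize the tuples over every generic \<open>y\<close> by the
  same finite set \<open>P\<close> of permutations of the indices, so the count is a finite sum of
  indicators.\<close>

lemma measurable_tuple_count [measurable]:
  assumes E: "E \<in> sets (power_space d)"
  shows "tuple_count E \<in> measurable borel (count_space UNIV)"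
proof -
  obtain s where s: "\<And>i. i < d \<Longrightarrow> s i \<in> borel_measurable borel"
    and bij: "\<And>y. y \<in> generic \<Longrightarrow> bij_betw (\<lambda>i. s i y) {..<d} (fibre y)"
    using borel_sections by blast
  define P where "P = inj_tuples d {..<d}"
  define \<Phi> where "\<Phi> = (\<lambda>\<sigma> y. tuple_map d (\<lambda>i. s i y) \<sigma>)"
  have P: "finite P" "\<And>\<sigma> i. \<sigma> \<in> P \<Longrightarrow> i < d \<Longrightarrow> \<sigma> i < d"
    by (auto simp: P_def finite_inj_tuples) (auto simp: inj_tuples_def)
  have \<Phi>: "\<Phi> \<sigma> \<in> measurable borel (power_space d)" if "\<sigma> \<in> P" for \<sigma>
    unfolding \<Phi>_def tuple_map_def power_space_def using that P(2) s
    by (intro measurable_restrict) auto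
  have "tuple_count E y = (if y \<in> generic then \<Sum>\<sigma>\<in>P. if \<Phi> \<sigma> y \<in> E then 1 else 0 else 0)" for y
  proof (cases "y \<in> generic")
    case True
    have "bij_betw (\<lambda>\<sigma>. \<Phi> \<sigma> y) P (tuples y)"
      unfolding \<Phi>_def P_def tuples_def using bij_betw_inj_tuples[OF bij[OF True]] .
    then have "card (E \<inter> tuples y) = card {\<sigma> \<in> P. \<Phi> \<sigma> y \<in> E}"
      by (rule card_bij_betw_restrict[symmetric])
    also have "\<dots> = (\<Sum>\<sigma>\<in>P. if \<Phi> \<sigma> y \<in> E then 1 else 0)"
      using P(1) by (simp add: sum.If_cases Int_def)
    finally show ?thesis using True by (simp add: tuple_count_def)
  qed (simp add: tuple_count_def)
  then have "tuple_count E = (\<lambda>y. if y \<in> generic then \<Sum>\<sigma>\<in>P. if \<Phi> \<sigma> y \<in> E then 1 else 0 else 0)"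
    by blast
  moreover have "(\<lambda>y. if \<Phi> \<sigma> y \<in> E then 1 else 0 :: nat) \<in> measurable borel (count_space UNIV)" if "\<sigma> \<in> P" for \<sigma>
    using \<Phi>[OF that] E by measurable
  ultimately show ?thesis by simp measurable
qed

section \<open>The invariant measure that counts tuples\<close>

text \<open>Left unnormalized, with total mass \<open>d!\<close>, so that a set with constant count
  has that integer as its measure. Countable additivity is checked in
  \<open>emeasure_tuple_measure\<close>.\<close>

definition tuple_measure :: "(nat \<Rightarrow> 'a) measure" where
  "tuple_measure = measure_of (space (power_space d)) (sets (power_space d))
     (\<lambda>E. \<integral>\<^sup>+y. of_nat (tuple_count E y) \<partial>\<nu>)"

lemma sets_tuple_measure [simp, measurable_cong]: "sets tuple_measure = sets (power_space d)"
  unfolding tuple_measure_def by (simp add: sets.sigma_sets_eq del: space_power_space)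

lemma emeasure_tuple_measure:
  assumes "E \<in> sets (power_space d)"
  shows "emeasure tuple_measure E = (\<integral>\<^sup>+y. of_nat (tuple_count E y) \<partial>\<nu>)"
  unfolding tuple_measure_def
proof (rule emeasure_measure_of_sigma)
  show "sigma_algebra (space (power_space d)) (sets (power_space d :: (nat \<Rightarrow> 'a) measure))" ..
  show "positive (sets (power_space d)) (\<lambda>E. \<integral>\<^sup>+y. of_nat (tuple_count E y) \<partial>\<nu>)"
  proof -
    have "tuple_count {} = (\<lambda>_. 0)" by (auto simp: tuple_count_def)
    then show ?thesis by (simp add: positive_def)
  qed
  show "countably_additive (sets (power_space d)) (\<lambda>E. \<integral>\<^sup>+y. of_nat (tuple_count E y) \<partial>\<nu>)"
  proof (rule countably_additiveI)
    fix A :: "nat \<Rightarrow> (nat \<Rightarrow> 'a) set"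
    assume A: "range A \<subseteq> sets (power_space d)" "disjoint_family A"
    have "(\<Sum>i. of_nat (tuple_count (A i) y) :: ennreal) = of_nat (tuple_count (\<Union>i. A i) y)" for y
      using suminf_card_disjoint[OF A(2) finite_tuples[of y]]
      by (cases "y \<in> generic") (simp_all add: tuple_count_def)
    moreover have "(\<lambda>y. of_nat (tuple_count (A i) y) :: ennreal) \<in> borel_measurable \<nu>" for i
      using A(1) by measurable
    ultimately show "(\<Sum>i. \<integral>\<^sup>+y. of_nat (tuple_count (A i) y) \<partial>\<nu>) = (\<integral>\<^sup>+y. of_nat (tuple_count (\<Union>i. A i) y) \<partial>\<nu>)"
      by (subst nn_integral_suminf[symmetric]) auto
  qed
qed (fact assms)

lemma emeasure_tuple_measure_F:
  assumes [measurable]: "E \<in> sets (power_space d)"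
  shows "emeasure tuple_measure (F -` E \<inter> space (power_space d)) = emeasure tuple_measure E"
proof -
  have "emeasure tuple_measure E = (\<integral>\<^sup>+y. of_nat (tuple_count E y) \<partial>distr \<nu> borel S)"
    by (simp add: emeasure_tuple_measure distr_nu)
  also have "\<dots> = (\<integral>\<^sup>+y. of_nat (tuple_count E (S y)) \<partial>\<nu>)"
    by (rule nn_integral_distr) measurable
  also have "\<dots> = emeasure tuple_measure (F -` E \<inter> space (power_space d))"
    by (subst emeasure_tuple_measure[OF measurable_sets[OF measurable_F assms]])
      (simp only: tuple_count_F)
  finally show ?thesis by simp
qed

lemma tuple_count_invariant:
  assumes "A \<in> sets (power_space d)" "F -` A \<inter> space (power_space d) = A"
  shows "\<exists>k. AE y in \<nu>. tuple_count A y = k"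
  using ergodic_measures_constant[OF nu_ergodic measurable_tuple_count[OF assms(1)]]
    tuple_count_F[of A] assms(2) by simp

section \<open>Degree joinings\<close>

definition invariant_sets :: "(nat \<Rightarrow> 'a) set set" where
  "invariant_sets = {A \<in> sets (power_space d). F -` A \<inter> space (power_space d) = A}"

lemma emeasure_tuple_measure_const:
  assumes "A \<in> sets (power_space d)" "AE y in \<nu>. tuple_count A y = k"
  shows "emeasure tuple_measure A = of_nat k"
proof -
  interpret prob_space \<nu> by (rule prob_space_nu)
  have "emeasure tuple_measure A = (\<integral>\<^sup>+y. of_nat k \<partial>\<nu>)"
    unfolding emeasure_tuple_measure[OF assms(1)]
    by (rule nn_integral_cong_AE) (use assms(2) in eventually_elim, simp)
  then show ?thesis by (simp add: emeasure_space_1[simplified])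
qed

text \<open>Counts are natural numbers, so a least positive constant exists; the whole space shows
  that there is one. An invariant subset has a constant at most \<open>n\<close>, hence 0 or
  \<open>n\<close> by minimality. Integrality replaces an ergodic decomposition.\<close>

lemma minimal_invariant_set:
  obtains A n where "A \<in> invariant_sets" "0 < n" "AE y in \<nu>. tuple_count A y = n"
    "\<And>B. B \<in> invariant_sets \<Longrightarrow> B \<subseteq> A \<Longrightarrow>
       (AE y in \<nu>. tuple_count B y = 0) \<or> (AE y in \<nu>. tuple_count B y = n)"
proof -
  interpret prob_space \<nu> by (rule prob_space_nu)
  define Q where "Q = (\<lambda>n. 0 < n \<and> (\<exists>A\<in>invariant_sets. AE y in \<nu>. tuple_count A y = n))"
  have top: "space (power_space d) \<in> invariant_sets"
    using measurable_space[OF measurable_F] by (auto simp: invariant_sets_def simp del: space_power_space)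
  obtain k where k: "AE y in \<nu>. tuple_count (space (power_space d)) y = k"
    using tuple_count_invariant[of "space (power_space d)"] top by (auto simp: invariant_sets_def)
  have "0 < k"
  proof (rule ccontr)
    assume "\<not> 0 < k"
    have "AE y in \<nu>. False"
      using k AE_generic
    proof eventually_elim
      case (elim y)
      then have "card (tuples y) = 0"
        using \<open>\<not> 0 < k\<close> tuples_space[of y] by (simp add: tuple_count_def Int_absorb1)
      then show ?case using elim(2) finite_tuples tuples_nonempty by simp
    qed
    then show False by simp
  qed
  then have "Q k" using k top by (auto simp: Q_def)
  define n where "n = (LEAST n. Q n)"
  have "Q n" unfolding n_def by (rule LeastI) fact
  then obtain A where A: "A \<in> invariant_sets" "AE y in \<nu>. tuple_count A y = n" and n: "0 < n"
    by (auto simp: Q_def)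
  show thesis
  proof (rule that[OF A(1) n A(2)])
    fix B assume B: "B \<in> invariant_sets" "B \<subseteq> A"
    obtain m where m: "AE y in \<nu>. tuple_count B y = m"
      using tuple_count_invariant[of B] B(1) by (auto simp: invariant_sets_def)
    have "AE y in \<nu>. m \<le> n"
      using m A(2) AE_generic
    proof eventually_elim
      case (elim y)
      have "card (B \<inter> tuples y) \<le> card (A \<inter> tuples y)"
        using B(2) finite_tuples[OF elim(3)] by (intro card_mono) auto
      with elim show ?case by (simp add: tuple_count_def)
    qed
    then have "m \<le> n" by simp
    moreover have "n \<le> m" if "0 < m"
      unfolding n_def using that m B(1) by (intro Least_le) (auto simp: Q_def)
    ultimately have "m = 0 \<or> m = n" by force
    then show "(AE y in \<nu>. tuple_count B y = 0) \<or> (AE y in \<nu>. tuple_count B y = n)"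
    proof
      assume "m = 0"
      show ?thesis using m unfolding \<open>m = 0\<close> by (rule disjI1)
    next
      assume "m = n"
      show ?thesis using m unfolding \<open>m = n\<close> by (rule disjI2)
    qed
  qed
qed

text \<open>Through a Borel injection into the reals, equality in \<open>Y\<close> becomes equality
  of real measurable functions.\<close>

lemma fiber_product_measurable: "fiber_product d \<pi> \<in> sets (power_space d)"
proof -
  obtain c :: "'b \<Rightarrow> real" where c: "c \<in> borel_measurable borel" and inj: "inj c"
    using compact_UNIV_borel_embedding[OF compact_Y] by blast
  have "fiber_product d \<pi> =
      {x \<in> space (power_space d). \<forall>i\<in>{..<d}. \<forall>j\<in>{..<d}. c (\<pi> (x i)) = c (\<pi> (x j))}"
    unfolding fiber_product_def space_power_space Ball_def lessThan_iff inj_eq[OF inj] ..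
  also have "\<dots> \<in> sets (power_space d)"
  proof (intro sets.sets_Collect_finite_All finite_lessThan)
    fix i j assume "i \<in> {..<d}" "j \<in> {..<d}"
    then show "{x \<in> space (power_space d). c (\<pi> (x i)) = c (\<pi> (x j))} \<in> sets (power_space d)"
      by (intro borel_measurable_eq measurable_compose[OF measurable_coordinate]
          measurable_compose[OF measurable_pi c]) simp_all
  qed
  finally show ?thesis .
qed

lemma separated_measurable: "{x \<in> space (power_space d). inj_on x {..<d}} \<in> sets (power_space d :: (nat \<Rightarrow> 'a) measure)"
proof -
  obtain c :: "'a \<Rightarrow> real" where c: "c \<in> borel_measurable borel" and inj: "inj c"
    using compact_UNIV_borel_embedding[OF compact_X] by blast
  have "{x \<in> space (power_space d). inj_on x {..<d}} =
      {x \<in> space (power_space d). \<forall>i\<in>{..<d}. \<forall>j\<in>{..<d}. c (x i) = c (x j) \<longrightarrow> i = j}"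
    unfolding inj_on_def inj_eq[OF inj] ..
  also have "\<dots> \<in> sets (power_space d)"
  proof (intro sets.sets_Collect_finite_All finite_lessThan)
    fix i j assume "i \<in> {..<d}" "j \<in> {..<d}"
    then have "{x \<in> space (power_space d). c (x i) \<noteq> c (x j)} \<in> sets (power_space d)"
      by (intro borel_measurable_neq measurable_compose[OF measurable_coordinate c]) simp_all
    then show "{x \<in> space (power_space d). c (x i) = c (x j) \<longrightarrow> i = j} \<in> sets (power_space d)"
      by (cases "i = j") (simp_all del: space_power_space)
  qed
  finally show ?thesis .
qed

lemma degree_joining_exists: "\<exists>\<rho>. degree_joining T \<pi> \<nu> \<rho>"
proof -
  interpret prob_space \<nu> by (rule prob_space_nu)
  obtain A n where A: "A \<in> invariant_sets" and n: "0 < n" and An: "AE y in \<nu>. tuple_count A y = n"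
    and min: "\<And>B. B \<in> invariant_sets \<Longrightarrow> B \<subseteq> A \<Longrightarrow>
       (AE y in \<nu>. tuple_count B y = 0) \<or> (AE y in \<nu>. tuple_count B y = n)"
    using minimal_invariant_set by metis
  have A_sets [measurable]: "A \<in> sets (power_space d)" and A_inv: "F -` A \<inter> space (power_space d) = A"
    using A by (auto simp: invariant_sets_def)
  have MA: "emeasure tuple_measure A = of_nat n"
    by (rule emeasure_tuple_measure_const[OF A_sets An])
  define \<rho> where "\<rho> = uniform_measure tuple_measure A"
  have sets_\<rho>: "sets \<rho> = sets (power_space d)" by (simp add: \<rho>_def)
  have space_\<rho>: "space \<rho> = space (power_space d)" by (rule sets_eq_imp_space_eq[OF sets_\<rho>])
  interpret R: prob_space \<rho>
    unfolding \<rho>_def using n MA by (intro prob_space_uniform_measure) auto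
  have em: "emeasure \<rho> E = emeasure tuple_measure (A \<inter> E) / of_nat n" if "E \<in> sets (power_space d)" for E
    using that by (simp add: \<rho>_def MA)
  \<comment> \<open>A set containing all tuples over generic points does not change the count of
    \<open>A\<close>. This yields both concentration on the fiber product and separation.\<close>
  have full: "R.prob E = 1"
    if E: "E \<in> sets (power_space d)" and tup: "\<And>y. y \<in> generic \<Longrightarrow> tuples y \<subseteq> E" for E
  proof -
    have "AE y in \<nu>. tuple_count (A \<inter> E) y = n"
      using An AE_generic
    proof eventually_elim
      case (elim y)
      have "A \<inter> E \<inter> tuples y = A \<inter> tuples y" using tup[OF elim(2)] by blast
      then show ?case using elim by (simp add: tuple_count_def)
    qed
    then have "emeasure \<rho> E = 1"
      using n E by (simp add: em emeasure_tuple_measure_const[of _ n] ennreal_of_nat_eq_real_of_nat divide_ennreal)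
    then show ?thesis by (simp add: R.emeasure_eq_measure)
  qed
  have inv: "\<rho> \<in> invariant_measures (power_space d) F"
  proof -
    have "distr \<rho> (power_space d) F = \<rho>"
    proof (rule measure_eqI)
      fix E assume "E \<in> sets (distr \<rho> (power_space d) F)"
      then have E: "E \<in> sets (power_space d)" by simp
      \<comment> \<open>Since \<open>A\<close> is invariant, cutting with \<open>A\<close> commutes
        with preimages under \<open>F\<close>, so invariance passes from
        \<open>tuple_measure\<close> to its restriction.\<close>
      have "A \<inter> (F -` E \<inter> space (power_space d)) = F -` (A \<inter> E) \<inter> space (power_space d)"
        using A_inv by blast
      then have "emeasure \<rho> (F -` E \<inter> space (power_space d)) = emeasure \<rho> E"
        using E measurable_sets[OF measurable_F E]
          emeasure_tuple_measure_F[of "A \<inter> E"] by (simp only: em sets.Int[OF A_sets])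
      moreover have "F \<in> measurable \<rho> (power_space d)"
        using measurable_F measurable_cong_sets[OF sets_\<rho> refl] by blast
      ultimately show "emeasure (distr \<rho> (power_space d) F) E = emeasure \<rho> E"
        using E by (simp only: emeasure_distr space_\<rho>)
    qed (simp add: sets_\<rho>)
    then show ?thesis
      using sets_\<rho> measurable_F R.prob_space_axioms by (simp add: invariant_measures_def)
  qed
  have erg: "\<rho> \<in> ergodic_measures (power_space d) F"
  proof -
    have "R.prob B = 0 \<or> R.prob B = 1" if B: "B \<in> sets (power_space d)" "F -` B \<inter> space (power_space d) = B" for B
    proof -
      have AB: "A \<inter> B \<in> invariant_sets"
        using A_sets A_inv B by (auto simp: invariant_sets_def)
      then have AB_sets: "A \<inter> B \<in> sets (power_space d)" by (simp add: invariant_sets_def)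
      \<comment> \<open>The minimal set cannot be split: the part in \<open>B\<close> counts 0 or
        \<open>n\<close> tuples, which normalizes to 0 or 1.\<close>
      from min[OF AB] have "emeasure \<rho> B = 0 \<or> emeasure \<rho> B = 1"
      proof
        assume "AE y in \<nu>. tuple_count (A \<inter> B) y = 0"
        from emeasure_tuple_measure_const[OF AB_sets this] show ?thesis using B(1) by (simp add: em)
      next
        assume "AE y in \<nu>. tuple_count (A \<inter> B) y = n"
        from emeasure_tuple_measure_const[OF AB_sets this] show ?thesis
          using B(1) n by (simp add: em ennreal_of_nat_eq_real_of_nat divide_ennreal)
      qed auto
      then show ?thesis by (simp add: R.emeasure_eq_measure)
    qed
    then show ?thesis using inv by (simp add: ergodic_measures_def)
  qed
  have fib: "R.prob (fiber_product d \<pi>) = 1"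
    by (rule full[OF fiber_product_measurable])
      (auto simp: tuples_def inj_tuples_def fiber_product_def PiE_iff extensional_def)
  have sep: "separating d \<rho>"
  proof -
    have "R.prob {x \<in> space (power_space d). inj_on x {..<d}} = 1"
      by (rule full[OF separated_measurable]) (auto simp: tuples_def inj_tuples_def)
    from R.AE_prob_1[OF this] show ?thesis unfolding separating_def by eventually_elim simp
  qed
  have "distr (marginal 0 \<rho>) borel \<pi> = \<nu>"
  proof (rule measure_eqI)
    fix B assume "B \<in> sets (distr (marginal 0 \<rho>) borel \<pi>)"
    then have B [measurable]: "B \<in> sets borel" by simp
    let ?E = "{x \<in> space (power_space d). \<pi> (x 0) \<in> B}"
    have proj [measurable]: "(\<lambda>x. x 0) \<in> borel_measurable (power_space d)"
      by (rule measurable_coordinate[OF degree_pos])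
    have proj_\<rho>: "(\<lambda>x. x 0) \<in> borel_measurable \<rho>"
      using proj measurable_cong_sets[OF sets_\<rho> refl] by blast
    have E: "?E \<in> sets (power_space d)" by measurable
    have "emeasure tuple_measure (A \<inter> ?E) = (\<integral>\<^sup>+y. of_nat (tuple_count (A \<inter> ?E) y) \<partial>\<nu>)"
      using E by (intro emeasure_tuple_measure) auto
    \<comment> \<open>All tuples over \<open>y\<close> project to \<open>y\<close>, so the condition
      keeps all \<open>n\<close> tuples when \<open>y\<close> is in \<open>B\<close> and none
      otherwise.\<close>
    also have "\<dots> = (\<integral>\<^sup>+y. of_nat n * indicator B y \<partial>\<nu>)"
    proof (rule nn_integral_cong_AE)
      show "AE y in \<nu>. (of_nat (tuple_count (A \<inter> ?E) y) :: ennreal) = of_nat n * indicator B y"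
        using An AE_generic
      proof eventually_elim
        case (elim y)
        have "\<pi> (x 0) = y" if "x \<in> tuples y" for x
          using that degree_pos by (auto simp: tuples_def inj_tuples_def PiE_iff)
        then have "A \<inter> ?E \<inter> tuples y = (if y \<in> B then A \<inter> tuples y else {})"
          using tuples_space[of y] by auto
        then show ?case using elim by (simp add: tuple_count_def)
      qed
    qed
    also have "\<dots> = of_nat n * emeasure \<nu> B" by (subst nn_integral_cmult_indicator) auto
    finally have "emeasure \<rho> ?E = emeasure \<nu> B"
      using n E by (simp add: em ennreal_mult_divide_eq mult.commute[of "of_nat n"])
    then show "emeasure (distr (marginal 0 \<rho>) borel \<pi>) B = emeasure \<nu> B"
      unfolding marginal_def
      by (simp add: emeasure_distr proj_\<rho> space_\<rho> vimage_def Int_def conj_commute)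
  qed simp
  then have "joining_over d \<pi> \<nu> \<rho>" using degree_pos by (auto simp: joining_over_def)
  with inv erg fib sep have "degree_joining T \<pi> \<nu> \<rho>"
    using degree by (simp add: degree_joining_def relative_joining_def)
  then show ?thesis by blast
qed

text \<open>The \<open>i\<close>-th projection intertwines \<open>F\<close> with \<open>T\<close>,
  so invariance and ergodicity descend to the marginal.\<close>

lemma marginal_ergodic_lift:
  assumes \<rho>: "degree_joining T \<pi> \<nu> \<rho>" and i: "i < d"
  shows "marginal i \<rho> \<in> ergodic_lifts T \<pi> \<nu>"
proof -
  have fib: "measure \<rho> (fiber_product d \<pi>) = 1"
    and erg: "\<rho> \<in> ergodic_measures (power_space d) F"
    and over: "joining_over d \<pi> \<nu> \<rho>"
    using \<rho> degree by (auto simp: degree_joining_def relative_joining_def)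
  have inv: "distr \<rho> (power_space d) F = \<rho>" and sets_\<rho> [measurable_cong]: "sets \<rho> = sets (power_space d)"
    and "prob_space \<rho>"
    using erg by (auto simp: ergodic_measures_def invariant_measures_def)
  interpret R: prob_space \<rho> by fact
  have space_\<rho>: "space \<rho> = space (power_space d)" by (rule sets_eq_imp_space_eq[OF sets_\<rho>])
  note proj = measurable_coordinate[where n = d]
  have proj_\<rho>: "(\<lambda>x. x k) \<in> borel_measurable \<rho>" if "k < d" for k
    using proj[OF that] measurable_cong_sets[OF sets_\<rho> refl] by blast
  let ?\<mu> = "marginal i \<rho>"
  have prob: "prob_space ?\<mu>"
    unfolding marginal_def by (rule R.prob_space_distr[OF proj_\<rho>[OF i]])
  have "distr ?\<mu> borel T = distr \<rho> borel (T \<circ> (\<lambda>x. x i))"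
    unfolding marginal_def by (rule distr_distr[OF measurable_T proj_\<rho>[OF i]])
  also have "\<dots> = distr \<rho> borel ((\<lambda>x. x i) \<circ> F)"
    using i by (simp add: comp_def power_map_def)
  also have "\<dots> = distr (distr \<rho> (power_space d) F) borel (\<lambda>x. x i)"
    by (rule distr_distr[symmetric, OF proj[OF i]])
      (use measurable_F measurable_cong_sets[OF sets_\<rho> refl] in blast)
  finally have invT: "distr ?\<mu> borel T = ?\<mu>" by (simp add: inv marginal_def)
  have ergT: "measure ?\<mu> A = 0 \<or> measure ?\<mu> A = 1" if A: "A \<in> sets borel" "T -` A = A" for A
  proof -
    let ?E = "(\<lambda>x. x i) -` A \<inter> space (power_space d)"
    have "?E \<in> sets (power_space d)" by (rule measurable_sets[OF proj[OF i] A(1)])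
    moreover have "F -` ?E \<inter> space (power_space d) = ?E"
    proof -
      have "F x i \<in> A \<longleftrightarrow> x i \<in> A" for x using A(2) i by (auto simp: power_map_def)
      then show ?thesis using measurable_space[OF measurable_F] by blast
    qed
    ultimately have "measure \<rho> ?E = 0 \<or> measure \<rho> ?E = 1"
      using erg by (auto simp: ergodic_measures_def)
    then show ?thesis
      unfolding marginal_def using measure_distr[OF proj_\<rho>[OF i] A(1)] by (simp add: space_\<rho>)
  qed
  \<comment> \<open>\<open>joining_over\<close> speaks of one coordinate only; on the fiber product
    all coordinates have the same image under \<open>\<pi>\<close>, which transfers it to
    \<open>i\<close>.\<close>
  obtain j where j: "j < d" "distr (marginal j \<rho>) borel \<pi> = \<nu>"
    using over by (auto simp: joining_over_def)
  have "distr ?\<mu> borel \<pi> = distr \<rho> borel (\<lambda>x. \<pi> (x i))"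
    unfolding marginal_def using distr_distr[OF measurable_pi proj_\<rho>[OF i]] by (simp add: comp_def)
  also have "\<dots> = distr \<rho> borel (\<lambda>x. \<pi> (x j))"
  proof (rule distr_cong_AE[OF refl refl])
    show "(\<lambda>x. \<pi> (x i)) \<in> borel_measurable \<rho>"
      by (rule measurable_compose[OF proj_\<rho>[OF i] measurable_pi])
    show "(\<lambda>x. \<pi> (x j)) \<in> borel_measurable \<rho>"
      by (rule measurable_compose[OF proj_\<rho>[OF j(1)] measurable_pi])
    show "AE x in \<rho>. \<pi> (x i) = \<pi> (x j)"
      using R.AE_prob_1[OF fib]
    proof eventually_elim
      case (elim x)
      then have "\<forall>i<d. \<forall>j<d. \<pi> (x i) = \<pi> (x j)" unfolding fiber_product_def by blast
      then show ?case using i j(1) by blast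
    qed
  qed
  also have "\<dots> = distr (marginal j \<rho>) borel \<pi>"
    unfolding marginal_def using distr_distr[OF measurable_pi proj_\<rho>[OF j(1)]] by (simp add: comp_def)
  finally have "distr ?\<mu> borel \<pi> = \<nu>" using j(2) by simp
  moreover have "sets ?\<mu> = sets borel" by (simp add: marginal_def)
  ultimately show ?thesis
    using prob invT ergT
    by (simp add: ergodic_lifts_def ergodic_measures_def invariant_measures_def)
qed

end

section \<open>Grouping the coordinates by their marginals\<close>

theorem theorem5p3:
  fixes T :: "'a::metric_space \<Rightarrow> 'a"
    and S :: "'b::metric_space \<Rightarrow> 'b"
    and \<pi> :: "'a \<Rightarrow> 'b"
    and \<nu> :: "'b measure"
    and d :: nat
  assumes "factor_quadruple T S \<pi> \<nu>"
    and "factor_degree \<pi> \<nu> = enat d"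
  shows "((\<lambda>\<mu>. lift_multiplicity T \<pi> \<nu> \<mu>) has_sum d) (ergodic_lifts T \<pi> \<nu>)"
proof -
  interpret finite_degree_quadruple T S \<pi> \<nu> d
    using assms by unfold_locales
  \<comment> \<open>The same choice as inside \<open>lift_multiplicity\<close>, so multiplicities
    count coordinates of this very joining.\<close>
  define \<rho> where "\<rho> = (SOME \<rho>. degree_joining T \<pi> \<nu> \<rho>)"
  have \<rho>: "degree_joining T \<pi> \<nu> \<rho>"
    unfolding \<rho>_def by (rule someI_ex[OF degree_joining_exists])
  have mult: "lift_multiplicity T \<pi> \<nu> \<mu> = card {i \<in> {..<d}. marginal i \<rho> = \<mu>}" for \<mu>
    by (simp add: lift_multiplicity_def degree \<rho>_def)
  let ?L = "(\<lambda>i. marginal i \<rho>) ` {..<d}"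
  show ?thesis
  \<comment> \<open>Lifts that are not marginals have multiplicity 0, so the sum over all ergodic
    lifts reduces to the finitely many marginals.\<close>
  proof (rule has_sum_finite_neutralI[of ?L])
    show "?L \<subseteq> ergodic_lifts T \<pi> \<nu>" using marginal_ergodic_lift[OF \<rho>] by blast
    show "lift_multiplicity T \<pi> \<nu> \<mu> = 0" if "\<mu> \<in> ergodic_lifts T \<pi> \<nu> - ?L" for \<mu>
    proof -
      have "{i \<in> {..<d}. marginal i \<rho> = \<mu>} = {}" using that by auto
      then show ?thesis unfolding mult by (simp only: card.empty)
    qed
    show "d = (\<Sum>\<mu>\<in>?L. lift_multiplicity T \<pi> \<nu> \<mu>)"
      using sum.image_gen[of "{..<d}" "\<lambda>_. 1::nat" "\<lambda>i. marginal i \<rho>"] by (simp add: mult)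
  qed simp
qed

end
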